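(* If $w$ is a positive integer, then every graph with layered treewidth at most $w$ is conflict-free $(8w-1)$-choosable.
   Context: All graphs are finite and simple. A tree-decomposition of $G$ is a family $(B_x:x\in V(T))$ of subsets of $V(G)$ indexed by the nodes of a tree $T$ such that for each vertex $v$ the set $\{x: v\in B_x\}$ induces a nonempty connected subtree, and each edge of $G$ has both ends in some $B_x$. A layering of $G$ is an ordered partition $(V_i:i\in\mathbb N)$ of $V(G)$ such that for every edge $vw$ there is $i$ with $\{v,w\}\subseteq V_i\cup V_{i+1}$. The layered treewidth of $G$ is the minimum, over all layerings $\mathcal V$ and tree-decompositions $\mathcal T$ of $G$, of $\max\{|V\cap B|: V\in\mathcal V, B\in\mathcal T\}$. For a real $k$, a $k$-list-assignment assigns each vertex $v$ a set $L(v)$ with $|L(v)|\ge k$; $G$ is conflict-free $k$-choosable if for every $k$-list-assignment $L$ there is a proper coloring $\phi$ with $\phi(v)\in L(v)$ for all $v$ such that every vertex with nonempty open neighbourhood $N_G(v)$ has some color appearing on exactly one vertex of $N_G(v)$. *)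

theory Defs
  imports Complex_Main "HOL-Library.Disjoint_Sets" "Graph_Theory.Graph_Theory"
begin

text \<open>
  Finite simple graphs are the loop-free symmetric digraphs of the locale
  \<^locale>\<open>pair_graph\<close>: an edge \<open>uv\<close> is the pair of arcs \<open>(u, v)\<close>, \<open>(v, u)\<close>.
  In such a digraph \<open>u, v, u\<close> counts as a \<open>cycle\<close>, so the library's \<open>forest\<close> and \<open>tree\<close> do not
  describe undirected trees with an edge. An undirected cycle is a directed one of length at least 3.
\<close>

definition undirected_tree :: "'n pair_pre_digraph \<Rightarrow> bool" where
  "undirected_tree T \<longleftrightarrow> pair_graph T \<and> connected T \<and>
     \<not> (\<exists>p. pre_digraph.cycle T p \<and> length p \<ge> 3)"

text \<open>Note that \<^const>\<open>connected\<close> includes nonemptiness of the vertex set.\<close>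

definition tree_decomposition ::
  "'a pair_pre_digraph \<Rightarrow> 'n pair_pre_digraph \<Rightarrow> ('n \<Rightarrow> 'a set) \<Rightarrow> bool" where
  "tree_decomposition G T B \<longleftrightarrow>
     undirected_tree T \<and>
     (\<forall>x \<in> pverts T. B x \<subseteq> pverts G) \<and>
     (\<forall>v \<in> pverts G. connected (with_proj T \<restriction> {x \<in> pverts T. v \<in> B x})) \<and>
     (\<forall>(u, v) \<in> parcs G. \<exists>x \<in> pverts T. u \<in> B x \<and> v \<in> B x)"

text \<open>Layers may be empty.\<close>

definition layering :: "'a pair_pre_digraph \<Rightarrow> (nat \<Rightarrow> 'a set) \<Rightarrow> bool" where
  "layering G V \<longleftrightarrow>
     disjoint_family V \<and> (\<Union>i. V i) = pverts G \<and>
     (\<forall>(u, v) \<in> parcs G. \<exists>i. {u, v} \<subseteq> V i \<union> V (Suc i))"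

definition layered_width ::
  "(nat \<Rightarrow> 'a set) \<Rightarrow> 'n pair_pre_digraph \<Rightarrow> ('n \<Rightarrow> 'a set) \<Rightarrow> nat" where
  "layered_width V T B = Max {card (V i \<inter> B x) | i x. x \<in> pverts T}"

text \<open>
  The nodes of the decomposition tree are taken to be natural numbers, which is no restriction
  because the tree is finite.
\<close>

definition layered_treewidth :: "'a pair_pre_digraph \<Rightarrow> nat" where
  "layered_treewidth G =
     (LEAST k. \<exists>V (T :: nat pair_pre_digraph) B.
        layering G V \<and> tree_decomposition G T B \<and> k = layered_width V T B)"

text \<open>The minimum and the maximum in these definitions are attained.\<close>

lemma layered_width_set:
  assumes "pair_graph G" "layering G V" "tree_decomposition G T B"
  shows "finite {card (V i \<inter> B x) | i x. x \<in> pverts T}"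
    and "{card (V i \<inter> B x) | i x. x \<in> pverts T} \<noteq> {}"
proof -
  interpret pair_graph G by fact
  have fin: "finite (pverts G)" by (rule pair_finite_verts)
  have "card (V i \<inter> B x) \<le> card (pverts G)" for i x
    using assms(2) fin by (intro card_mono) (auto simp: layering_def)
  then have "{card (V i \<inter> B x) | i x. x \<in> pverts T} \<subseteq> {..card (pverts G)}" by auto
  then show "finite {card (V i \<inter> B x) | i x. x \<in> pverts T}"
    by (rule finite_subset) simp
  have "pverts T \<noteq> {}"
    using assms(3) by (auto simp: tree_decomposition_def undirected_tree_def
        connected_def strongly_connected_def mk_symmetric_def)
  then show "{card (V i \<inter> B x) | i x. x \<in> pverts T} \<noteq> {}" by auto
qed

lemma layered_treewidth_attained:
  assumes "pair_graph G"
  shows "\<exists>V (T :: nat pair_pre_digraph) B.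
    layering G V \<and> tree_decomposition G T B \<and> layered_treewidth G = layered_width V T B"
proof -
  interpret pair_graph G by fact
  define T :: "nat pair_pre_digraph" where "T = \<lparr>pverts = {0}, parcs = {}\<rparr>"
  define V where "V = (\<lambda>i::nat. if i = 0 then pverts G else {})"
  define B where "B = (\<lambda>x::nat. pverts G)"
  have con: "connected (with_proj T)" "connected (with_proj T \<restriction> {0})"
    by (auto simp: T_def connected_def strongly_connected_def mk_symmetric_def reachable_def
        intro: rtrancl_on_refl)
  have "pair_graph T"
    by unfold_locales (auto simp: T_def symmetric_def sym_def)
  moreover have "\<not> pre_digraph.cycle (with_proj T) p" for p
    by (cases p) (auto simp: pre_digraph.cycle_def pre_digraph.awalk_def T_def)
  ultimately have "undirected_tree T" using con by (auto simp: undirected_tree_def)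
  then have "tree_decomposition G T B"
    using con by (auto simp: tree_decomposition_def B_def T_def dest: in_arcsD1 in_arcsD2)
  moreover have "layering G V"
    by (fastforce simp: layering_def disjoint_family_on_def V_def
        dest: in_arcsD1 in_arcsD2 split: if_splits)
  ultimately have "\<exists>k V (T :: nat pair_pre_digraph) B.
    layering G V \<and> tree_decomposition G T B \<and> k = layered_width V T B" by blast
  then show ?thesis unfolding layered_treewidth_def by (rule LeastI_ex)
qed

definition neighbourhood :: "'a pair_pre_digraph \<Rightarrow> 'a \<Rightarrow> 'a set" where
  "neighbourhood G v = {u. (v, u) \<in> parcs G}"

text \<open>Infinite lists are allowed; they need a separate case since \<^const>\<open>card\<close> is 0 on them.\<close>

definition list_assignment :: "'a pair_pre_digraph \<Rightarrow> real \<Rightarrow> ('a \<Rightarrow> 'c set) \<Rightarrow> bool" where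
  "list_assignment G k L \<longleftrightarrow> (\<forall>v \<in> pverts G. infinite (L v) \<or> real (card (L v)) \<ge> k)"

definition proper_colouring :: "'a pair_pre_digraph \<Rightarrow> ('a \<Rightarrow> 'c) \<Rightarrow> bool" where
  "proper_colouring G \<phi> \<longleftrightarrow> (\<forall>(u, v) \<in> parcs G. \<phi> u \<noteq> \<phi> v)"

definition conflict_free :: "'a pair_pre_digraph \<Rightarrow> ('a \<Rightarrow> 'c) \<Rightarrow> bool" where
  "conflict_free G \<phi> \<longleftrightarrow>
     (\<forall>v \<in> pverts G. neighbourhood G v \<noteq> {} \<longrightarrow>
        (\<exists>c. \<exists>!u. u \<in> neighbourhood G v \<and> \<phi> u = c))"

text \<open>
  A HOL definition cannot quantify over all types of colours, so the type is a parameter; a theorem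
  stated with a type variable there covers all of them.
\<close>

definition conflict_free_choosable :: "'c itself \<Rightarrow> 'a pair_pre_digraph \<Rightarrow> real \<Rightarrow> bool" where
  "conflict_free_choosable _ G k \<longleftrightarrow>
     (\<forall>L :: 'a \<Rightarrow> 'c set. list_assignment G k L \<longrightarrow>
        (\<exists>\<phi>. proper_colouring G \<phi> \<and> (\<forall>v \<in> pverts G. \<phi> v \<in> L v) \<and> conflict_free G \<phi>))"

end

theory Submission
  imports Defs
begin

text \<open>
  Root the tree and order the vertices of \<open>G\<close> by the roots of their subtrees of bags, so that a
  neighbour \<open>u\<close> of \<open>v\<close> preceding \<open>v\<close>, as well as a vertex preceding \<open>v\<close> that has with \<open>v\<close> a common
  neighbour following \<open>v\<close>, lies in the root bag of \<open>v\<close>. Colour greedily in this order, protecting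
  for each \<open>u\<close> the colour of its first neighbour \<open>first u\<close>: the vertex \<open>v\<close> avoids the colours of its
  earlier neighbours \<open>u\<close> and of \<open>first u\<close> for all neighbours \<open>u\<close>. The earlier neighbours, and
  \<open>first u\<close> for later \<open>u\<close>, are in the root bag of \<open>v\<close> within two layers of \<open>v\<close>, so there are at most
  \<open>5 w - 1\<close> of them; the earlier \<open>u\<close> are within one layer, which gives at most \<open>3 w - 1\<close> further
  vertices \<open>first u\<close>. Hence at most \<open>8 w - 2\<close> colours are forbidden.
\<close>

section \<open>Walks, connectedness and search orders in trees\<close>

text \<open>Every walk shortens to a simple path; this is applied in the digraph \<open>H\<close> of
  the arcs of \<open>r\<close> inside \<open>A\<close>, so that the path stays in
  \<open>A\<close>.\<close>

lemma rtrancl_on_pawalkE: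
  assumes "(x, y) \<in> rtrancl_on A r"
  obtains p where "pcas x p y" "set p \<subseteq> r" "distinct (pawalk_verts x p)" "set (pawalk_verts x p) \<subseteq> A"
proof -
  define H where "H = \<lparr>pverts = A, parcs = r \<inter> A \<times> A\<rparr>"
  interpret H: pair_wf_digraph H by unfold_locales (auto simp: H_def)
  have "(x, y) \<in> rtrancl_on A (r \<inter> A \<times> A)"
    using assms by (induction rule: rtrancl_on_induct) (auto intro: rtrancl_on_into_rtrancl_on)
  then have "x \<rightarrow>\<^sup>*\<^bsub>with_proj H\<^esub> y" by (simp add: reachable_def H_def)
  then obtain p where p: "H.apath x p y" using H.reachable_apath by blast
  then have "set (pawalk_verts x p) \<subseteq> A"
    using H.awalk_verts_in_verts[of x p] unfolding H.apath_def H.awalk_def by (auto simp: H_def)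
  with p show thesis
    unfolding H.apath_def H.awalk_def by (intro that[of p]) (auto simp: H_def)
qed

text \<open>\<open>connected\<close> speaks of the symmetric closure of the arcs, which adds nothing
  here because the arcs of \<open>T\<close> are symmetric already.\<close>

lemma connected_induceD:
  assumes "pair_graph T" "connected (with_proj T \<restriction> S)" "x \<in> S" "y \<in> S"
  shows "(x, y) \<in> rtrancl_on S (parcs T)"
proof -
  interpret pair_graph T by fact
  have "x \<rightarrow>\<^sup>*\<^bsub>with_proj (mk_symmetric (with_proj T \<restriction> S))\<^esub> y"
    using assms(2-4) by (simp add: connected_def strongly_connected_def)
  then have *: "(x, y) \<in> rtrancl_on S (parcs (mk_symmetric (with_proj T \<restriction> S)))"
    by (simp add: reachable_def)
  have "sym (parcs T)" using pair_sym_arcs by (simp add: symmetric_def)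
  then have "parcs (mk_symmetric (with_proj T \<restriction> S)) \<subseteq> parcs T"
    by (auto simp: parcs_mk_symmetric dest: symD)
  with * show ?thesis by (meson rtrancl_on_mono order_refl subsetD)
qed

text \<open>
  A search order of the tree: a vertex joined to a connected set of earlier vertices by two edges
  would close a cycle.
\<close>

lemma undirected_tree_search_order:
  assumes "undirected_tree T"
  obtains \<rho> :: "'n \<Rightarrow> nat"
  where "inj_on \<rho> (pverts T)"
    and "\<And>x y z. (x, y) \<in> parcs T \<Longrightarrow> (x, z) \<in> parcs T \<Longrightarrow> \<rho> y < \<rho> x \<Longrightarrow> \<rho> z < \<rho> x \<Longrightarrow> y = z"
proof -
  interpret pair_graph T using assms by (simp add: undirected_tree_def)
  have sym: "(x, y) \<in> parcs T \<Longrightarrow> (y, x) \<in> parcs T" for x y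
    using pair_sym_arcs by (auto simp: symmetric_def dest: symD)
  have acyclic: "\<not> (cycle p \<and> length p \<ge> 3)" for p
    using assms by (auto simp: undirected_tree_def)
  have conn: "pverts T \<noteq> {}" "x \<in> pverts T \<Longrightarrow> y \<in> pverts T \<Longrightarrow> (x, y) \<in> rtrancl_on (pverts T) (parcs T)"
    for x y
  proof -
    have c: "connected (with_proj T)" using assms by (simp add: undirected_tree_def)
    then show "pverts T \<noteq> {}" by (auto simp: connected_def strongly_connected_def)
    assume "x \<in> pverts T" "y \<in> pverts T"
    moreover have "with_proj T \<restriction> pverts T = with_proj T"
      by (auto simp: induce_subgraph_def with_proj_def dest: arc_fst_in_verts arc_snd_in_verts)
    ultimately show "(x, y) \<in> rtrancl_on (pverts T) (parcs T)"
      using c connected_induceD[of T "pverts T" x y] pair_graph_axioms by simp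
  qed
  \<comment> \<open>Invariant for growing the order one vertex at a time. Connectedness of
    \<open>A\<close> supplies the path that closes a cycle if a new vertex has two neighbours in
    \<open>A\<close>.\<close>
  define good where "good A \<rho> \<longleftrightarrow> A \<subseteq> pverts T \<and> inj_on \<rho> A \<and>
      (\<forall>x\<in>A. \<forall>y\<in>A. (x, y) \<in> rtrancl_on A (parcs T)) \<and>
      (\<forall>x\<in>A. \<forall>y\<in>A. \<forall>z\<in>A. (x, y) \<in> parcs T \<longrightarrow> (x, z) \<in> parcs T \<longrightarrow> \<rho> y < \<rho> x \<longrightarrow> \<rho> z < \<rho> x \<longrightarrow> y = z)"
    for A and \<rho> :: "'n \<Rightarrow> nat"
  have "\<exists>A \<rho>. card A = Suc n \<and> good A \<rho>" if "Suc n \<le> card (pverts T)" for n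
    using that
  proof (induction n)
    case 0
    from conn(1) obtain r where r: "r \<in> pverts T" by blast
    then have "good {r} (\<lambda>_. 0)" by (auto simp: good_def)
    then show ?case by (intro exI[of _ "{r}"] exI[of _ "\<lambda>_. 0"]) simp
  next
    case (Suc n)
    then obtain A \<rho> where card: "card A = Suc n" and A: "good A \<rho>" by auto
    then have sub: "A \<subseteq> pverts T" and inj: "inj_on \<rho> A"
      and cn: "\<And>x y. x \<in> A \<Longrightarrow> y \<in> A \<Longrightarrow> (x, y) \<in> rtrancl_on A (parcs T)"
      and un: "\<And>x y z. \<lbrakk>x \<in> A; y \<in> A; z \<in> A; (x, y) \<in> parcs T; (x, z) \<in> parcs T; \<rho> y < \<rho> x; \<rho> z < \<rho> x\<rbrakk> \<Longrightarrow> y = z"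
      by (auto simp: good_def)
    have fin: "finite A" using sub pair_finite_verts finite_subset by blast
    obtain a0 where a0: "a0 \<in> A" using card by fastforce
    have "A \<noteq> pverts T" using card Suc.prems by auto
    with sub obtain b0 where b0: "b0 \<in> pverts T" "b0 \<notin> A" by blast
    \<comment> \<open>A walk from \<open>a0\<close> to \<open>b0\<close> has to leave
      \<open>A\<close> somewhere.\<close>
    have "\<exists>a b. a \<in> A \<and> b \<notin> A \<and> (a, b) \<in> parcs T"
    proof (rule ccontr)
      assume no: "\<nexists>a b. a \<in> A \<and> b \<notin> A \<and> (a, b) \<in> parcs T"
      have "(a0, b0) \<in> rtrancl_on (pverts T) (parcs T)" using conn(2) a0 b0 sub by blast
      then have "b0 \<in> A" by (induction rule: rtrancl_on_induct) (use a0 no in auto)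
      with b0 show False by simp
    qed
    then obtain a b where ab: "a \<in> A" "b \<notin> A" "(a, b) \<in> parcs T" by blast
    \<comment> \<open>A simple path from \<open>a'\<close> to \<open>a\<close> inside
      \<open>A\<close> is nonempty if \<open>a'\<close> differs from \<open>a\<close>; with the two
      edges at \<open>b\<close> it forms a cycle of length at least 3.\<close>
    have only: "a' = a" if a': "a' \<in> A" "(b, a') \<in> parcs T" for a'
    proof (rule ccontr)
      assume neq: "a' \<noteq> a"
      obtain q where q: "pcas a' q a" "set q \<subseteq> parcs T" "distinct (pawalk_verts a' q)"
          "set (pawalk_verts a' q) \<subseteq> A"
        using cn[OF a'(1) ab(1)] by (rule rtrancl_on_pawalkE)
      have wq: "awalk a' q a" using q a' sub by (auto simp: awalk_def)
      let ?q = "q @ [(a, b)]"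
      have wb: "awalk a [(a, b)] b" using ab in_arcsD1 by (auto simp: awalk_def)
      have wq': "awalk a' ?q b" using wq wb by (rule awalk_appendI)
      have vq': "pawalk_verts a' ?q = pawalk_verts a' q @ [b]"
        using awalk_verts_append[OF wq'] wq by auto
      have "q \<noteq> []" using q(1) neq by auto
      then have "length ((b, a') # ?q) \<ge> 3" by (cases q) auto
      moreover have "awalk b ((b, a') # ?q) b" using wq' a' awalk_Cons_iff[of b "(b, a')" ?q b] in_arcsD1 by (simp del: awalk_append_iff)
      then have "cycle ((b, a') # ?q)" unfolding cycle_def
        by (intro exI[of _ b]) (use vq' q ab in auto)
      ultimately show False using acyclic by blast
    qed
    \<comment> \<open>The new vertex comes last, so it precedes no vertex of \<open>A\<close>, and
      the order on \<open>A\<close> is unchanged.\<close>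
    define \<rho>' where "\<rho>' = \<rho>(b := Suc (Max (\<rho> ` A)))"
    have less: "\<rho> x < Suc (Max (\<rho> ` A))" if "x \<in> A" for x
      using fin that by (simp add: less_Suc_eq_le)
    have old: "\<rho>' x = \<rho> x" if "x \<in> A" for x using that ab by (auto simp: \<rho>'_def)
    have new: "\<rho>' b = Suc (Max (\<rho> ` A))" by (simp add: \<rho>'_def)
    have "inj_on \<rho>' (insert b A)"
    proof -
      have "\<rho>' b \<notin> \<rho>' ` A" using less by (force simp: old new)
      moreover have "inj_on \<rho>' A" using inj by (simp add: old cong: inj_on_cong)
      ultimately show ?thesis using ab(2) by simp
    qed
    moreover have "(x, y) \<in> rtrancl_on (insert b A) (parcs T)" if "x \<in> insert b A" "y \<in> insert b A" for x y
    proof -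
      have m: "(x, y) \<in> rtrancl_on (insert b A) (parcs T)" if "x \<in> A" "y \<in> A" for x y
        using cn[OF that] by (induction rule: rtrancl_on_induct) (auto intro: rtrancl_on_into_rtrancl_on that)
      have "(x, a) \<in> rtrancl_on (insert b A) (parcs T)"
        using that(1) m[of x a] ab sym[of a b]
        by (auto intro: converse_rtrancl_on_into_rtrancl_on)
      moreover have "(a, y) \<in> rtrancl_on (insert b A) (parcs T)"
        using that(2) m[of a y] ab by (auto intro: rtrancl_on_into_rtrancl_on)
      ultimately show ?thesis by (rule rtrancl_on_trans)
    qed
    moreover have "y = z" if "x \<in> insert b A" "y \<in> insert b A" "z \<in> insert b A"
        "(x, y) \<in> parcs T" "(x, z) \<in> parcs T" "\<rho>' y < \<rho>' x" "\<rho>' z < \<rho>' x" for x y z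
    proof (cases "x = b")
      case True
      with that have "y \<in> A" "z \<in> A" by auto
      with True that only show ?thesis by blast
    next
      case False
      with that(1) have x: "x \<in> A" by simp
      then have "y \<noteq> b" "z \<noteq> b" using that(6,7) less[OF x] by (auto simp: old new)
      with that x show ?thesis by (intro un[of x y z]) (auto simp: old)
    qed
    ultimately have "good (insert b A) \<rho>'"
      unfolding good_def using sub in_arcsD2[OF ab(3)] by (intro conjI ballI impI) (blast | assumption)+
    moreover have "card (insert b A) = Suc (Suc n)" using fin ab card by simp
    ultimately show ?case by blast
  qed
  moreover have "card (pverts T) > 0" using conn(1) pair_finite_verts by (simp add: card_gt_0_iff)
  ultimately obtain A \<rho> where A: "card A = card (pverts T)" "good A \<rho>"
    by (metis Suc_pred order_refl)
  then have "A = pverts T" using pair_finite_verts by (intro card_subset_eq) (auto simp: good_def)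
  with A(2) show thesis
    unfolding good_def using in_arcsD1 in_arcsD2 by (intro that[of \<rho>]) blast+
qed

section \<open>Roots of the subtrees of bags\<close>

text \<open>
  With the tree rooted by a search order, \<open>t v\<close> is the root of the subtree of bags containing \<open>v\<close>;
  of two subtrees that meet, the one with the higher root contains the root of the other.
\<close>

lemma tree_decomposition_roots:
  assumes "tree_decomposition G T B"
  obtains t and \<rho> :: "'n \<Rightarrow> nat"
  where "\<And>v. v \<in> pverts G \<Longrightarrow> t v \<in> pverts T \<and> v \<in> B (t v)"
    and "\<And>u v x. \<lbrakk>u \<in> pverts G; v \<in> pverts G; x \<in> pverts T; u \<in> B x; v \<in> B x; \<rho> (t v) \<le> \<rho> (t u)\<rbrakk>
      \<Longrightarrow> v \<in> B (t u)"
proof -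
  have T: "undirected_tree T" using assms by (simp add: tree_decomposition_def)
  then interpret T: pair_graph T by (simp add: undirected_tree_def)
  have sym: "(x, y) \<in> parcs T \<Longrightarrow> (y, x) \<in> parcs T" for x y
    using T.pair_sym_arcs by (auto simp: symmetric_def dest: symD)
  obtain \<rho> :: "'n \<Rightarrow> nat" where inj: "inj_on \<rho> (pverts T)"
    and un: "\<And>x y z. (x, y) \<in> parcs T \<Longrightarrow> (x, z) \<in> parcs T \<Longrightarrow> \<rho> y < \<rho> x \<Longrightarrow> \<rho> z < \<rho> x \<Longrightarrow> y = z"
    using undirected_tree_search_order[OF T] by blast
  define S where "S v = {x \<in> pverts T. v \<in> B x}" for v
  define t where "t v = arg_min \<rho> (\<lambda>x. x \<in> S v)" for v
  \<comment> \<open>The parent relation of the rooted tree; by \<open>un\<close> it is a partial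
    function.\<close>
  define up where "up = {(x, y) \<in> parcs T. \<rho> y < \<rho> x}"
  have det: "y = z" if "(x, y) \<in> up" "(x, z) \<in> up" for x y z
    using that un by (auto simp: up_def)
  have dec: "\<rho> y \<le> \<rho> x" if "(x, y) \<in> rtrancl_on A up" for x y A
    using that by (induction rule: rtrancl_on_induct) (auto simp: up_def)
  have arc_cases: "(x, y) \<in> up \<or> (y, x) \<in> up" if "(x, y) \<in> parcs T" for x y
  proof -
    have "x \<noteq> y" "x \<in> pverts T" "y \<in> pverts T"
      using that T.pair_no_loops[of "(x, y)"] T.in_arcsD1 T.in_arcsD2 by auto
    then have "\<rho> x \<noteq> \<rho> y" using inj by (auto dest: inj_onD)
    then show ?thesis using that sym by (auto simp: up_def)
  qed
  have conn: "connected (with_proj T \<restriction> S v)" if "v \<in> pverts G" for v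
    using assms that by (auto simp: tree_decomposition_def S_def)
  have t_in: "t v \<in> S v" and t_le: "x \<in> S v \<Longrightarrow> \<rho> (t v) \<le> \<rho> x" if "v \<in> pverts G" for v x
  proof -
    have "S v \<noteq> {}" using conn[OF that] by (auto simp: connected_def strongly_connected_def)
    then obtain y where "y \<in> S v" by blast
    then show "t v \<in> S v" unfolding t_def by (rule arg_min_natI)
    show "x \<in> S v \<Longrightarrow> \<rho> (t v) \<le> \<rho> x" unfolding t_def by (rule arg_min_nat_le)
  qed
  have to_root: "(x, t v) \<in> rtrancl_on (S v) up" if v: "v \<in> pverts G" and x: "x \<in> S v" for v x
  proof -
    have "(x, t v) \<in> rtrancl_on (S v) (parcs T)"
      using connected_induceD[OF T.pair_graph_axioms conn[OF v] x t_in[OF v]] .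
    \<comment> \<open>Along a walk inside \<open>S v\<close> from \<open>x\<close>, the current node
      and \<open>x\<close> keep a common ancestor reached inside \<open>S v\<close>. A step down
      prolongs the ascent of the current node; a step up shortens it or, if it was trivial, makes
      the new node the common ancestor. At the end of the walk, minimality of
      \<open>\<rho> (t v)\<close> forces this ancestor to be \<open>t v\<close>.\<close>
    then have "\<exists>c. (x, c) \<in> rtrancl_on (S v) up \<and> (t v, c) \<in> rtrancl_on (S v) up"
    proof (induction rule: rtrancl_on_induct)
      case base
      then show ?case by blast
    next
      case (step y z)
      then obtain c where c: "(x, c) \<in> rtrancl_on (S v) up" "(y, c) \<in> rtrancl_on (S v) up" by blast
      from arc_cases[OF step(2)] show ?case
      proof
        assume yz: "(y, z) \<in> up"
        from c(2) show ?thesis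
        proof (cases rule: converse_rtrancl_on_cases)
          case base
          then show ?thesis using c yz step by (meson rtrancl_on_into_rtrancl_on rtrancl_on_refl)
        next
          case (step d)
          then show ?thesis using c yz det by blast
        qed
      next
        assume "(z, y) \<in> up"
        then show ?thesis using c step by (meson converse_rtrancl_on_into_rtrancl_on)
      qed
    qed
    then obtain c where c: "(x, c) \<in> rtrancl_on (S v) up" "(t v, c) \<in> rtrancl_on (S v) up" by blast
    have "c \<in> S v" using c(1) by (rule in_rtrancl_on_in_F)
    moreover have "\<rho> c = \<rho> (t v)" using dec[OF c(2)] t_le[OF v \<open>c \<in> S v\<close>] by simp
    ultimately have "c = t v" using inj t_in[OF v] by (auto simp: S_def dest: inj_onD)
    with c show ?thesis by simp
  qed
  \<comment> \<open>Two ascents from \<open>x\<close> follow the same path since parents are unique: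
    the second passes through \<open>y\<close>, or it stops below \<open>y\<close> and the rest of
    the first leads from its end \<open>z\<close> to \<open>y\<close>.\<close>
  have confl: "y \<in> S' \<or> (z, y) \<in> rtrancl_on S up"
    if "(x, y) \<in> rtrancl_on S up" "(x, z) \<in> rtrancl_on S' up" for x y z S S'
    using that(2,1)
  proof (induction rule: rtrancl_on_induct)
    case base
    then show ?case by blast
  next
    case (step z z')
    then consider "y \<in> S'" | "(z, y) \<in> rtrancl_on S up" by blast
    then show ?case
    proof cases
      case 2
      then show ?thesis
      proof (cases rule: converse_rtrancl_on_cases)
        case base
        then show ?thesis using step by blast
      next
        case (step c)
        then show ?thesis using det \<open>(z, z') \<in> up\<close> by blast
      qed
    qed blast
  qed
  show thesis
  proof (rule that[of t \<rho>])
    show "t v \<in> pverts T \<and> v \<in> B (t v)" if "v \<in> pverts G" for v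
      using t_in[OF that] by (simp add: S_def)
    show "v \<in> B (t u)" if "u \<in> pverts G" "v \<in> pverts G" "x \<in> pverts T" "u \<in> B x" "v \<in> B x"
        "\<rho> (t v) \<le> \<rho> (t u)" for u v x
    proof -
      have "x \<in> S u" "x \<in> S v" using that by (auto simp: S_def)
      from confl[OF to_root[OF that(1) this(1)] to_root[OF that(2) this(2)]]
      show ?thesis
      proof
        assume "t u \<in> S v"
        then show ?thesis by (simp add: S_def)
      next
        assume "(t v, t u) \<in> rtrancl_on (S u) up"
        then have "\<rho> (t u) = \<rho> (t v)" using dec that(6) by force
        then have "t u = t v" using inj t_in that(1,2) by (auto simp: S_def dest: inj_onD)
        then show ?thesis using t_in[OF that(2)] by (simp add: S_def)
      qed
    qed
  qed
qed

section \<open>Vertex orders and greedy list colouring\<close>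

text \<open>Distinct vertices of \<open>G\<close> can have the same root, so ordering them by root
  needs a tie-break. The pair of \<open>g v\<close> and a number \<open>h v < card V\<close> is
  ordered lexicographically by encoding it as \<open>g v * card V + h v\<close>.\<close>

lemma finite_linearise:
  fixes g :: "'a \<Rightarrow> nat"
  assumes "finite V"
  obtains f :: "'a \<Rightarrow> nat" where "inj_on f V" "\<And>u v. u \<in> V \<Longrightarrow> v \<in> V \<Longrightarrow> f u < f v \<Longrightarrow> g u \<le> g v"
proof -
  obtain h where h: "bij_betw h V {0..<card V}" using ex_bij_betw_finite_nat[OF assms] by blast
  then have lt: "v \<in> V \<Longrightarrow> h v < card V" for v by (auto simp: bij_betw_def)
  define f where "f v = g v * card V + h v" for v
  have md: "f v mod card V = h v" if "v \<in> V" for v using lt[OF that] by (simp add: f_def)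
  have "inj_on f V"
  proof (rule inj_onI)
    fix u v assume "u \<in> V" "v \<in> V" "f u = f v"
    then have "h u = h v" using md by metis
    with \<open>u \<in> V\<close> \<open>v \<in> V\<close> show "u = v" using h by (auto simp: bij_betw_def dest: inj_onD)
  qed
  moreover have "g u \<le> g v" if "u \<in> V" "v \<in> V" "f u < f v" for u v
  proof (rule ccontr)
    assume "\<not> g u \<le> g v"
    then have "Suc (g v) * card V \<le> g u * card V" by (intro mult_le_mono1) simp
    then have "f v < f u" using lt[OF that(2)] by (simp add: f_def)
    with that show False by simp
  qed
  ultimately show thesis by (rule that)
qed

text \<open>When \<open>v\<close> has its turn, all of \<open>D v\<close> is coloured and
  \<open>L v\<close> has a colour left. Forbidding colours through \<open>D\<close> rather than
  through edges lets one run serve both properness and conflict-freeness.\<close>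

lemma greedy_list_colouring:
  fixes f :: "'a \<Rightarrow> nat" and L :: "'a \<Rightarrow> 'c set"
  assumes "finite V" "inj_on f V"
    and D: "\<And>v. v \<in> V \<Longrightarrow> D v \<subseteq> {p \<in> V. f p < f v}"
    and L: "\<And>v. v \<in> V \<Longrightarrow> infinite (L v) \<or> card (D v) < card (L v)"
  obtains \<phi> where "\<And>v. v \<in> V \<Longrightarrow> \<phi> v \<in> L v" "\<And>v p. v \<in> V \<Longrightarrow> p \<in> D v \<Longrightarrow> \<phi> p \<noteq> \<phi> v"
proof -
  have "\<exists>\<phi>. \<forall>v\<in>V. f v < n \<longrightarrow> \<phi> v \<in> L v \<and> (\<forall>p\<in>D v. \<phi> p \<noteq> \<phi> v)" for n
  proof (induction n)
    case 0
    then show ?case by simp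
  next
    case (Suc n)
    then obtain \<phi> where \<phi>: "\<And>v. v \<in> V \<Longrightarrow> f v < n \<Longrightarrow> \<phi> v \<in> L v \<and> (\<forall>p\<in>D v. \<phi> p \<noteq> \<phi> v)" by blast
    show ?case
    proof (cases "\<exists>v\<in>V. f v = n")
      case False
      then show ?thesis using \<phi> by (metis less_Suc_eq)
    next
      case True
      then obtain v where v: "v \<in> V" "f v = n" by blast
      have fin: "finite (D v)" using D[OF v(1)] assms(1) by (auto intro: finite_subset)
      have "\<not> L v \<subseteq> \<phi> ` D v"
      proof
        assume sub: "L v \<subseteq> \<phi> ` D v"
        then have "finite (L v)" using fin finite_subset by blast
        moreover have "card (L v) \<le> card (D v)"
          using sub fin by (meson card_image_le card_mono finite_imageI le_trans)
        ultimately show False using L[OF v(1)] by simp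
      qed
      then obtain c where c: "c \<in> L v" "c \<notin> \<phi> ` D v" by blast
      \<comment> \<open>Colouring \<open>v\<close> disturbs no earlier \<open>u\<close>, as
        \<open>D u\<close> contains only vertices before \<open>u\<close>.\<close>
      have "(\<phi>(v := c)) u \<in> L u \<and> (\<forall>p\<in>D u. (\<phi>(v := c)) p \<noteq> (\<phi>(v := c)) u)"
        if u: "u \<in> V" "f u < Suc n" for u
      proof (cases "u = v")
        case True
        then show ?thesis using c D[OF v(1)] by auto
      next
        case False
        then have "f u < n" using u v assms(2) by (metis inj_onD less_SucE)
        moreover from this have "v \<notin> D u" using D[OF u(1)] v by auto
        ultimately show ?thesis using \<phi>[OF u(1)] False by auto
      qed
      then show ?thesis by blast
    qed
  qed
  from this[of "Suc (Max (f ` V))"] show thesis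
    using assms(1) that by (auto simp: less_Suc_eq_le)
qed

lemma card_layers_Int_bag:
  assumes "finite I" "\<And>i. card (V i \<inter> X) \<le> w"
  shows "card ((\<Union>i\<in>I. V i) \<inter> X) \<le> card I * w"
proof -
  have "card ((\<Union>i\<in>I. V i) \<inter> X) = card (\<Union>i\<in>I. V i \<inter> X)" by simp
  also have "\<dots> \<le> (\<Sum>i\<in>I. card (V i \<inter> X))" using assms(1) by (rule card_UN_le)
  also have "\<dots> \<le> card I * w" using assms(2) by (intro sum_bounded_above[THEN order_trans]) auto
  finally show ?thesis .
qed

section \<open>Counting forbidden colours and colouring the graph\<close>

theorem theorem1p6:
  fixes G :: "'a pair_pre_digraph" and w :: nat
  assumes "w > 0"
    and "pair_graph G"
    and "layered_treewidth G \<le> w"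
  shows "conflict_free_choosable TYPE('c) G (8 * real w - 1)"
  unfolding conflict_free_choosable_def
proof (intro allI impI)
  fix L :: "'a \<Rightarrow> 'c set"
  assume L: "list_assignment G (8 * real w - 1) L"
  interpret pair_graph G by fact
  have sym: "(x, y) \<in> parcs G \<Longrightarrow> (y, x) \<in> parcs G" for x y
    using pair_sym_arcs by (auto simp: symmetric_def dest: symD)
  obtain V and T :: "nat pair_pre_digraph" and B where
    V: "layering G V" and TB: "tree_decomposition G T B" and wd: "layered_width V T B \<le> w"
    using layered_treewidth_attained[OF assms(2)] assms(3) by auto
  have width: "card (V i \<inter> B x) \<le> w" if "x \<in> pverts T" for i x
  proof -
    have "card (V i \<inter> B x) \<le> layered_width V T B"
      unfolding layered_width_def
      by (rule Max_ge[OF layered_width_set(1)[OF assms(2) V TB]]) (use that in blast)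
    with wd show ?thesis by simp
  qed
  have finV: "finite (V i)" for i
    using V finite_subset[OF _ pair_finite_verts, of "V i"] by (auto simp: layering_def)
  have "\<exists>i. v \<in> V i" if "v \<in> pverts G" for v using V that by (auto simp: layering_def)
  then obtain l where l: "\<And>v. v \<in> pverts G \<Longrightarrow> v \<in> V (l v)" by metis
  have l_eq: "l v = i" if "v \<in> V i" for v i
  proof -
    have "v \<in> V (l v)" using V that by (intro l) (auto simp: layering_def)
    moreover have "disjoint_family V" using V by (simp add: layering_def)
    ultimately show ?thesis using that by (auto simp: disjoint_family_on_def)
  qed
  have l_adj: "l u \<le> Suc (l v) \<and> l v \<le> Suc (l u)" if "(u, v) \<in> parcs G" for u v
  proof -
    have "\<forall>(u, v) \<in> parcs G. \<exists>i. {u, v} \<subseteq> V i \<union> V (Suc i)"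
      using V unfolding layering_def by (elim conjE)
    from bspec[OF this that] obtain i where "{u, v} \<subseteq> V i \<union> V (Suc i)" by auto
    then have "l u \<in> {i, Suc i}" "l v \<in> {i, Suc i}" using l_eq by blast+
    then show ?thesis by auto
  qed
  obtain t and \<rho> :: "nat \<Rightarrow> nat"
    where t: "\<And>v. v \<in> pverts G \<Longrightarrow> t v \<in> pverts T \<and> v \<in> B (t v)"
      and meet: "\<And>u v x. \<lbrakk>u \<in> pverts G; v \<in> pverts G; x \<in> pverts T; u \<in> B x; v \<in> B x; \<rho> (t v) \<le> \<rho> (t u)\<rbrakk>
        \<Longrightarrow> v \<in> B (t u)"
    using tree_decomposition_roots[OF TB] by blast
  obtain f :: "'a \<Rightarrow> nat" where inj: "inj_on f (pverts G)"
    and f: "\<And>u v. u \<in> pverts G \<Longrightarrow> v \<in> pverts G \<Longrightarrow> f u < f v \<Longrightarrow> \<rho> (t u) \<le> \<rho> (t v)"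
    using finite_linearise[OF pair_finite_verts, of "\<lambda>v. \<rho> (t v)"] by blast
  \<comment> \<open>For an isolated \<open>u\<close> the value is arbitrary; \<open>first u\<close>
    is used only when \<open>u\<close> has a neighbour.\<close>
  define first where "first u = arg_min f (\<lambda>v. v \<in> neighbourhood G u)" for u
  have first: "(u, first u) \<in> parcs G" "f (first u) \<le> f v" if "(u, v) \<in> parcs G" for u v
  proof -
    have "v \<in> neighbourhood G u" using that by (simp add: neighbourhood_def)
    then have "first u \<in> neighbourhood G u" "f (first u) \<le> f v"
      unfolding first_def by (rule arg_min_natI, rule arg_min_nat_le)
    then show "(u, first u) \<in> parcs G" "f (first u) \<le> f v" by (auto simp: neighbourhood_def)
  qed
  have first_less: "f (first u) < f v" if "(u, v) \<in> parcs G" "v \<noteq> first u" for u v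
    using first[OF that(1)] that inj in_arcsD2 by (metis inj_onD le_neq_implies_less)
  \<comment> \<open>The bag containing the edge makes the two subtrees meet, and the root of
    \<open>v\<close> does not precede that of \<open>u\<close>.\<close>
  have earlier_nbr: "u \<in> B (t v)" if "(u, v) \<in> parcs G" "f u < f v" for u v
  proof -
    obtain x where "x \<in> pverts T" "u \<in> B x" "v \<in> B x"
      using TB \<open>(u, v) \<in> parcs G\<close> by (auto simp: tree_decomposition_def)
    then show ?thesis using that meet[of v u x] f in_arcsD1 in_arcsD2 by blast
  qed
  \<comment> \<open>The condition \<open>f p < f v\<close> loses no constraint: an edge is treated
    at its later end, and \<open>first u\<close> precedes all other neighbours of
    \<open>u\<close>.\<close>
  define D where "D v = {p \<in> pverts G. f p < f v \<and>
    ((p, v) \<in> parcs G \<or> (\<exists>u. (u, v) \<in> parcs G \<and> p = first u))}" for v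
  have card_D: "card (D v) \<le> 8 * w - 2" if v: "v \<in> pverts G" for v
  proof -
    \<comment> \<open>Truncated subtraction only shortens the interval near layer 0, so at most
      \<open>2 * k + 1\<close> layers occur.\<close>
    define R where "R k = (\<Union>i\<in>{l v - k..l v + k}. V i) \<inter> B (t v)" for k
    have finR: "finite (R k)" and vR: "v \<in> R k" for k
      using finV t[OF v] l[OF v] by (auto simp: R_def intro!: bexI[of _ "l v"])
    have RI: "p \<in> R k" if "p \<in> pverts G" "p \<in> B (t v)" "l p \<le> l v + k" "l v \<le> l p + k" for p k
      using that l[of p] by (auto simp: R_def intro!: bexI[of _ "l p"])
    have card_R: "card (R k - {v}) \<le> (2 * k + 1) * w - 1" for k
    proof -
      have "card (R k) \<le> card {l v - k..l v + k} * w"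
        unfolding R_def using width t[OF v] by (intro card_layers_Int_bag) auto
      also have "\<dots> \<le> (2 * k + 1) * w" by (intro mult_le_mono1) simp
      finally show ?thesis using vR by (simp add: finR)
    qed
    have "D v \<subseteq> (R 2 - {v}) \<union> first ` (R 1 - {v})"
    proof
      fix p assume "p \<in> D v"
      then have p: "p \<in> pverts G" "f p < f v" and
        "(p, v) \<in> parcs G \<or> (\<exists>u. (u, v) \<in> parcs G \<and> p = first u)" by (auto simp: D_def)
      then consider "(p, v) \<in> parcs G" | u where "(u, v) \<in> parcs G" "p = first u" by blast
      then show "p \<in> (R 2 - {v}) \<union> first ` (R 1 - {v})"
      proof cases
        case 1
        then show ?thesis using RI[of p 2] earlier_nbr[of p v] l_adj[of p v] p by auto
      next
        case 2
        then have u: "u \<in> pverts G" "u \<noteq> v" using in_arcsD1 pair_no_loops[of "(u, v)"] by auto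
        have up: "(u, p) \<in> parcs G" using first(1)[OF 2(1)] 2 by simp
        show ?thesis
        proof (cases "f u < f v")
          case True
          then have "u \<in> R 1" using RI[of u 1] earlier_nbr[of u v] l_adj[of u v] 2 u by auto
          then show ?thesis using 2 u by blast
        next
          case False
          \<comment> \<open>\<open>u\<close> comes after both \<open>p\<close> and \<open>v\<close>, so both lie in the root bag of \<open>u\<close>.\<close>
          then have "f v < f u" using u v inj by (metis inj_onD linorder_neqE_nat)
          then have "p \<in> B (t u)" "v \<in> B (t u)"
            using earlier_nbr[of p u] earlier_nbr[of v u] sym up 2 p by auto
          \<comment> \<open>The subtrees of \<open>p\<close> and \<open>v\<close> meet at
            \<open>t u\<close>, and \<open>p\<close> precedes \<open>v\<close>. Their layers differ
            by at most 2, by way of \<open>u\<close>.\<close>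
          then have "p \<in> B (t v)" using meet[of v p "t u"] f p v t[OF u(1)] by blast
          then show ?thesis using RI[of p 2] l_adj[OF up] l_adj[OF 2(1)] p by auto
        qed
      qed
    qed
    then have "card (D v) \<le> card ((R 2 - {v}) \<union> first ` (R 1 - {v}))"
      using finR by (intro card_mono) auto
    also have "\<dots> \<le> card (R 2 - {v}) + card (first ` (R 1 - {v}))" by (rule card_Un_le)
    also have "\<dots> \<le> card (R 2 - {v}) + card (R 1 - {v})"
      using finR by (intro add_left_mono card_image_le) auto
    \<comment> \<open>As \<open>w > 0\<close>, the subtractions are exact: (5w - 1) + (3w - 1) = 8w
      - 2.\<close>
    also have "\<dots> \<le> 8 * w - 2" using card_R[of 2] card_R[of 1] assms(1) by simp
    finally show ?thesis .
  qed
  have "infinite (L v) \<or> card (D v) < card (L v)" if "v \<in> pverts G" for v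
  proof (cases "infinite (L v)")
    case False
    then have "8 * real w - 1 \<le> real (card (L v))" using L that by (auto simp: list_assignment_def)
    then have "8 * w - 1 \<le> card (L v)" by linarith
    then show ?thesis using card_D[OF that] assms(1) by linarith
  qed simp
  then obtain \<phi> where \<phi>: "\<And>v. v \<in> pverts G \<Longrightarrow> \<phi> v \<in> L v"
      "\<And>v p. v \<in> pverts G \<Longrightarrow> p \<in> D v \<Longrightarrow> \<phi> p \<noteq> \<phi> v"
    by (rule greedy_list_colouring[OF pair_finite_verts inj, of D L, rotated]) (auto simp: D_def)
  have "\<phi> u \<noteq> \<phi> v" if "(u, v) \<in> parcs G" for u v
  proof -
    have "u \<noteq> v" "u \<in> pverts G" "v \<in> pverts G" using that pair_no_loops[of "(u, v)"] in_arcsD1 in_arcsD2 by auto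
    then have "f u < f v \<or> f v < f u" using inj by (metis inj_onD linorder_neqE_nat)
    then have "u \<in> D v \<or> v \<in> D u" using that sym \<open>u \<in> _\<close> \<open>v \<in> _\<close> by (auto simp: D_def)
    then show ?thesis using \<phi>(2) \<open>u \<in> _\<close> \<open>v \<in> _\<close> by metis
  qed
  then have "proper_colouring G \<phi>" by (auto simp: proper_colouring_def)
  moreover have "conflict_free G \<phi>"
    unfolding conflict_free_def
  proof (intro ballI impI)
    fix u assume "neighbourhood G u \<noteq> {}"
    then obtain v0 where "(u, v0) \<in> parcs G" by (auto simp: neighbourhood_def)
    then have fu: "(u, first u) \<in> parcs G" by (rule first)
    \<comment> \<open>The unique colour at \<open>u\<close> is that of \<open>first u\<close>: every
      other neighbour \<open>v\<close> of \<open>u\<close> has \<open>first u\<close> in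
      \<open>D v\<close>.\<close>
    have "v = first u" if "(u, v) \<in> parcs G" "\<phi> v = \<phi> (first u)" for v
    proof (rule ccontr)
      assume "v \<noteq> first u"
      then have "first u \<in> D v" using first_less that(1) fu in_arcsD2 by (auto simp: D_def)
      then show False using \<phi>(2) that in_arcsD2 by metis
    qed
    then show "\<exists>c. \<exists>!v. v \<in> neighbourhood G u \<and> \<phi> v = c"
      using fu by (intro exI[of _ "\<phi> (first u)"] ex1I[of _ "first u"]) (auto simp: neighbourhood_def)
  qed
  ultimately show "\<exists>\<phi>. proper_colouring G \<phi> \<and> (\<forall>v\<in>pverts G. \<phi> v \<in> L v) \<and> conflict_free G \<phi>"
    using \<phi>(1) by blast
qed

end
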